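(* For any type $\sigma$ and any programs $M,N:\sigma$, we have $M\approx_{T_3}N$ if and only if $M\approx_{\mathrm{Ob}_{\mathrm{VDis}}}N$.
   Context: **Language.** Fix base types $b$, including $\mathtt{Bool}$ and $\mathtt{Rew}$; for each $b$ a set of constants $c:b$ (including $\mathtt{tt},\mathtt{ff}:\mathtt{Bool}$, $0:\mathtt{Rew}$); and function symbols $f:b_1\ldots b_m\to b$, including $=_b\,:b\,b\to\mathtt{Bool}$ for each $b$, $+:\mathtt{Rew}\,\mathtt{Rew}\to\mathtt{Rew}$, $\oplus_p:\mathtt{Rew}\,\mathtt{Rew}\to\mathtt{Rew}$ ($p\in[0,1]$) and $\le\,:\mathtt{Rew}\,\mathtt{Rew}\to\mathtt{Bool}$. Types: $\sigma::=b\mid\mathtt{Unit}\mid\sigma\times\sigma\mid\sigma\to\sigma$. Terms: $M::=x\mid c\mid f(M_1,\dots,M_m)\mid\mathtt{if}\,L\,\mathtt{then}\,M\,\mathtt{else}\,N\mid M\,\mathtt{or}\,N\mid N\cdot M\mid M+_pN\ (p\in[0,1])\mid *\mid\langle M,N\rangle\mid\mathtt{fst}(M)\mid\mathtt{snd}(M)\mid\lambda x{:}\sigma.M\mid MN$, up to $\alpha$-equivalence, with standard simple typing; $M\,\mathtt{or}\,N$ and $M+_pN$ have type $\sigma$ when $M,N:\sigma$, and $N\cdot M:\sigma$ when $N:\mathtt{Rew}$, $M:\sigma$. Programs are closed well-typed terms. Values (closed): $V::=c\mid *\mid\langle V,W\rangle\mid\lambda x{:}\sigma.M$; $\mathrm{Val}_\sigma$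 is the set of values of type $\sigma$. Effect values: $E::=V\mid E_1\,\mathtt{or}\,E_2\mid c\cdot E\mid E_1+_pE_2$ ($c:\mathtt{Rew}$). **Ordinary operational semantics.** Evaluation contexts (closed): $\mathcal E::=[\,]\mid f(c_1,\dots,c_{k-1},\mathcal E,M_{k+1},\dots,M_m)\mid\mathtt{if}\,\mathcal E\,\mathtt{then}\,M\,\mathtt{else}\,N\mid\mathcal E\cdot M\mid\langle\mathcal E,N\rangle\mid\langle V,\mathcal E\rangle\mid\mathtt{fst}(\mathcal E)\mid\mathtt{snd}(\mathcal E)\mid\mathcal EN\mid(\lambda x{:}\sigma.M)\mathcal E$. Constants $\mathrm{val}_f(c_1,\dots,c_m):b$ are given for all $f$ and $c_i:b_i$, with $\mathrm{val}_{=_b}(c,c')=\mathtt{tt}$ if $c=c'$, else $\mathtt{ff}$. Steps $\mathcal E[Q]\to\mathcal E[Q']$ arise from: $f(c_1,\dots,c_m)\to\mathrm{val}_f(c_1,\dots,c_m)$; $\mathtt{if}\,\mathtt{tt}\,\mathtt{then}\,M\,\mathtt{else}\,N\to M$; $\mathtt{if}\,\mathtt{ff}\,\mathtt{then}\,M\,\mathtt{else}\,N\to N$; $\mathtt{fst}\langle V,W\rangle\to V$; $\mathtt{snd}\langle V,W\rangle\to W$; $(\lambda x{:}\sigma.M)V\to M[V/x]$. Evaluation is deterministic and terminating, and each program $M:\sigma$ has an effect value $\mathrm{Op}(M):\sigma$ determined by $\mathrm{Op}(V)=V$; $\mathrm{Op}(M)=\mathrm{Op}(M')$ if $M\to M'$;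 $\mathrm{Op}(\mathcal E[M_1\,\mathtt{or}\,M_2])=\mathrm{Op}(\mathcal E[M_1])\,\mathtt{or}\,\mathrm{Op}(\mathcal E[M_2])$; $\mathrm{Op}(\mathcal E[M_1+_pM_2])=\mathrm{Op}(\mathcal E[M_1])+_p\mathrm{Op}(\mathcal E[M_2])$; $\mathrm{Op}(\mathcal E[c\cdot M_1])=c\cdot\mathrm{Op}(\mathcal E[M_1])$. **Rewards and interpretation.** A barycentric algebra is a set with binary operations $+_p$ ($p\in[0,1]$) such that $x+_1y=x$, $x+_px=x$, $x+_py=y+_{1-p}x$ and $(x+_py)+_qz=x+_{pq}(y+_{(1-p)q/(1-pq)}z)$ for $p,q<1$; finite convex combinations $\sum_ip_ix_i$ are then defined as usual. $R$ is a set with a barycentric algebra structure $+_p$, a commutative monoid structure $(+,0)$ with $r+(s+_ps')=(r+s)+_p(r+s')$, and a total order $\le$ such that for all $r,s,t$: $r\le s\iff r+t\le s+t$, and $r\le s\iff r+_pt\le s+_pt$ for $p\in(0,1)$. It is additionally assumed that $(r+x)+_p(s+y)=((r+_ps)+x)+_p((r+_ps)+y)$ for all $r,s,x,y\in R$, $p\in[0,1]$. Given are nonempty sets $[\![b]\!]$ with $[\![\mathtt{Bool}]\!]=\{0,1\}$, $[\![\mathtt{Rew}]\!]=R$; elements $[\![c]\!]\in[\![b]\!]$ for $c:b$ with $[\![\mathtt{tt}]\!]=1$, $[\![\mathtt{ff}]\!]=0$, $[\![0]\!]=0$, distinct constants of the same type having distinct denotations, and $[\![c]\!]\ne0$ for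 some $c:\mathtt{Rew}$; and functions $[\![f]\!]:[\![b_1]\!]\times\cdots\times[\![b_m]\!]\to[\![b]\!]$ with $[\![+]\!],[\![\oplus_p]\!],[\![\le]\!]$ the addition, the operation $+_p$ and the (characteristic function of the) order of $R$, and $[\![f]\!]([\![c_1]\!],\dots,[\![c_m]\!])=[\![\mathrm{val}_f(c_1,\dots,c_m)]\!]$. $DW(X)$ is the set of finitely supported probability distributions $\sum_ip_i\langle r_i,x_i\rangle$ on $R\times X$, with $r\cdot\sum_ip_i\langle r_i,x_i\rangle=\sum_ip_i\langle r+r_i,x_i\rangle$. The expected reward is $\mathbf E(\sum_ip_i\langle r_i,x_i\rangle)=\sum_ip_ir_i\in R$, and the value distribution is $\mathrm{VDis}(\sum_ip_i\langle r_i,x_i\rangle)=\sum_ip_ix_i$, a finite probability distribution on $X$. **Selection operational semantics.** Strategies: a value has the single strategy $*$; those of $E_1\,\mathtt{or}\,E_2$ are $1s$ ($s\in\mathrm{Str}(E_1)$) and $2s$ ($s\in\mathrm{Str}(E_2)$); those of $c\cdot E$ are those of $E$; those of $E_1+_pE_2$ are pairs $(s_1,s_2)$, $s_i\in\mathrm{Str}(E_i)$. Outcomes: $\mathrm{Out}( *,V)=\langle0,V\rangle$ (Dirac); $\mathrm{Out}(is,E_1\,\mathtt{or}\,E_2)=\mathrm{Out}(s,E_i)$; $\mathrm{Out}(s,c\cdot E)=[\![c]\!]\cdot\mathrm{Out}(s,E)$; $\mathrm{Out}((s_1,s_2),E_1+_pE_2)=p\,\mathrm{Out}(s_1,E_1)+(1-p)\,\mathrm{Out}(s_2,E_2)$.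 $\mathrm{Rew}(s,E)=\mathbf E(\mathrm{Out}(s,E))$. Strategies are totally ordered: on $E_1\,\mathtt{or}\,E_2$ all $1s$ precede all $2s'$, each group ordered as in $E_1$, resp. $E_2$; on $c\cdot E$ as in $E$; on $E_1+_pE_2$ lexicographically. $\mathrm{Op}_s(M)=\mathrm{Out}(s_{\rm opt},\mathrm{Op}(M))\in DW(\mathrm{Val}_\sigma)$, where $s_{\rm opt}$ is the least strategy of $\mathrm{Op}(M)$ maximizing $\mathrm{Rew}(s,\mathrm{Op}(M))$. **Observational equivalences.** For a function $\mathrm{Ob}$ on programs of type $\mathtt{Bool}$ and programs $M,N:\sigma$, $M\approx_{\mathrm{Ob}}N$ iff $\mathrm{Ob}(C[M])=\mathrm{Ob}(C[N])$ for every one-hole context $C[\;]$ such that $C[L]:\mathtt{Bool}$ is a program for every program $L:\sigma$. $\approx_{T_3}$ is $\approx_{\mathrm{Ob}}$ for $\mathrm{Ob}(M)=\mathrm{Ob}_{T_3}(M)=\langle\mathrm{VDis}(\mathrm{Op}_s(M)),\mathbf E(\mathrm{Op}_s(M))\rangle$, and $\mathrm{Ob}_{\mathrm{VDis}}(M)=\mathrm{VDis}(\mathrm{Op}_s(M))$. *)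

theory Defs
  imports "HOL-Probability.Probability"
begin

datatype 'b ty = Base 'b | UnitT | ProdT "'b ty" "'b ty" | FunT "'b ty" "'b ty"

text \<open>
  Terms up to alpha-equivalence are represented with de Bruijn indices.
  Choice probabilities are arbitrary reals in the raw syntax; the typing rules
  restrict them to the unit interval.  \<open>Rwd N M\<close> is the reward
  construct (N followed by M), \<open>PChoice p M N\<close> is probabilistic choice.
\<close>

datatype ('b, 'c, 'f) trm =
    Var nat
  | Const 'c
  | Fn 'f "('b, 'c, 'f) trm list"
  | Cond "('b, 'c, 'f) trm" "('b, 'c, 'f) trm" "('b, 'c, 'f) trm"
  | Or "('b, 'c, 'f) trm" "('b, 'c, 'f) trm"
  | Rwd "('b, 'c, 'f) trm" "('b, 'c, 'f) trm"
  | PChoice real "('b, 'c, 'f) trm" "('b, 'c, 'f) trm"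
  | Star
  | MkPair "('b, 'c, 'f) trm" "('b, 'c, 'f) trm"
  | Fst "('b, 'c, 'f) trm"
  | Snd "('b, 'c, 'f) trm"
  | Lam "'b ty" "('b, 'c, 'f) trm"
  | App "('b, 'c, 'f) trm" "('b, 'c, 'f) trm"

text \<open>
  The constants of base type \<open>b\<close> are those \<open>c\<close> with
  \<open>const_ty S c = b\<close>.  \<open>eq_sym\<close>, \<open>plus_sym\<close>, \<open>oplus_sym\<close> and
  \<open>le_sym\<close> pick out the distinguished function symbols.
  \<open>fn_val\<close> is the function on constants used by the ordinary operational semantics.
\<close>

record ('b, 'c, 'f) lang_sig =
  bool_ty :: 'b
  rew_ty :: 'b
  const_ty :: "'c \<Rightarrow> 'b"
  tt_const :: 'c
  ff_const :: 'c
  zero_const :: 'c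
  arg_tys :: "'f \<Rightarrow> 'b list"
  res_ty :: "'f \<Rightarrow> 'b"
  eq_sym :: "'b \<Rightarrow> 'f"
  plus_sym :: 'f
  oplus_sym :: "real \<Rightarrow> 'f"
  le_sym :: 'f
  fn_val :: "'f \<Rightarrow> 'c list \<Rightarrow> 'c"

locale language =
  fixes S :: "('b, 'c, 'f) lang_sig"
  assumes bool_neq_rew: "bool_ty S \<noteq> rew_ty S"
    and tt_ty: "const_ty S (tt_const S) = bool_ty S"
    and ff_ty: "const_ty S (ff_const S) = bool_ty S"
    and zero_ty: "const_ty S (zero_const S) = rew_ty S"
    and eq_ty: "\<And>b. arg_tys S (eq_sym S b) = [b, b]" "\<And>b. res_ty S (eq_sym S b) = bool_ty S"
    and plus_ty: "arg_tys S (plus_sym S) = [rew_ty S, rew_ty S]" "res_ty S (plus_sym S) = rew_ty S"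
    and oplus_ty: "\<And>p. p \<in> {0..1} \<Longrightarrow> arg_tys S (oplus_sym S p) = [rew_ty S, rew_ty S]"
      "\<And>p. p \<in> {0..1} \<Longrightarrow> res_ty S (oplus_sym S p) = rew_ty S"
    and le_ty: "arg_tys S (le_sym S) = [rew_ty S, rew_ty S]" "res_ty S (le_sym S) = bool_ty S"
    and fn_val_ty: "\<And>f cs. map (const_ty S) cs = arg_tys S f \<Longrightarrow> const_ty S (fn_val S f cs) = res_ty S f"
    and eq_val: "\<And>b c c'. \<lbrakk>const_ty S c = b; const_ty S c' = b\<rbrakk> \<Longrightarrow>
      fn_val S (eq_sym S b) [c, c'] = (if c = c' then tt_const S else ff_const S)"

inductive typing ::
  "('b, 'c, 'f) lang_sig \<Rightarrow> 'b ty list \<Rightarrow> ('b, 'c, 'f) trm \<Rightarrow> 'b ty \<Rightarrow> bool"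
  for S
where
  Var: "i < length \<Gamma> \<Longrightarrow> typing S \<Gamma> (Var i) (\<Gamma> ! i)"
| Const: "typing S \<Gamma> (Const c) (Base (const_ty S c))"
| Fn: "list_all2 (\<lambda>M b. typing S \<Gamma> M (Base b)) Ms (arg_tys S f) \<Longrightarrow>
    typing S \<Gamma> (Fn f Ms) (Base (res_ty S f))"
| Cond: "\<lbrakk>typing S \<Gamma> L (Base (bool_ty S)); typing S \<Gamma> M \<sigma>; typing S \<Gamma> N \<sigma>\<rbrakk> \<Longrightarrow> typing S \<Gamma> (Cond L M N) \<sigma>"
| Or: "\<lbrakk>typing S \<Gamma> M \<sigma>; typing S \<Gamma> N \<sigma>\<rbrakk> \<Longrightarrow> typing S \<Gamma> (Or M N) \<sigma>"
| Rwd: "\<lbrakk>typing S \<Gamma> N (Base (rew_ty S)); typing S \<Gamma> M \<sigma>\<rbrakk> \<Longrightarrow> typing S \<Gamma> (Rwd N M) \<sigma>"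
| PChoice: "\<lbrakk>p \<in> {0..1}; typing S \<Gamma> M \<sigma>; typing S \<Gamma> N \<sigma>\<rbrakk> \<Longrightarrow> typing S \<Gamma> (PChoice p M N) \<sigma>"
| Star: "typing S \<Gamma> Star UnitT"
| MkPair: "\<lbrakk>typing S \<Gamma> M \<sigma>; typing S \<Gamma> N \<tau>\<rbrakk> \<Longrightarrow> typing S \<Gamma> (MkPair M N) (ProdT \<sigma> \<tau>)"
| Fst: "typing S \<Gamma> M (ProdT \<sigma> \<tau>) \<Longrightarrow> typing S \<Gamma> (Fst M) \<sigma>"
| Snd: "typing S \<Gamma> M (ProdT \<sigma> \<tau>) \<Longrightarrow> typing S \<Gamma> (Snd M) \<tau>"
| Lam: "typing S (\<sigma> # \<Gamma>) M \<tau> \<Longrightarrow> typing S \<Gamma> (Lam \<sigma> M) (FunT \<sigma> \<tau>)"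
| App: "\<lbrakk>typing S \<Gamma> M (FunT \<sigma> \<tau>); typing S \<Gamma> N \<sigma>\<rbrakk> \<Longrightarrow> typing S \<Gamma> (App M N) \<tau>"

definition program :: "('b, 'c, 'f) lang_sig \<Rightarrow> ('b, 'c, 'f) trm \<Rightarrow> 'b ty \<Rightarrow> bool" where
  "program S M \<sigma> \<longleftrightarrow> typing S [] M \<sigma>"

primrec lift :: "('b, 'c, 'f) trm \<Rightarrow> nat \<Rightarrow> ('b, 'c, 'f) trm" where
  "lift (Var i) k = (if i < k then Var i else Var (Suc i))"
| "lift (Const c) k = Const c"
| "lift (Fn f Ms) k = Fn f (map (\<lambda>M. lift M k) Ms)"
| "lift (Cond L M N) k = Cond (lift L k) (lift M k) (lift N k)"
| "lift (Or M N) k = Or (lift M k) (lift N k)"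
| "lift (Rwd N M) k = Rwd (lift N k) (lift M k)"
| "lift (PChoice p M N) k = PChoice p (lift M k) (lift N k)"
| "lift Star k = Star"
| "lift (MkPair M N) k = MkPair (lift M k) (lift N k)"
| "lift (Fst M) k = Fst (lift M k)"
| "lift (Snd M) k = Snd (lift M k)"
| "lift (Lam \<sigma> M) k = Lam \<sigma> (lift M (Suc k))"
| "lift (App M N) k = App (lift M k) (lift N k)"

text \<open>
  \<open>subst M V k\<close> replaces index \<open>k\<close> by \<open>V\<close> and lowers the indices above \<open>k\<close>,
  as is appropriate when the corresponding binder is removed.
\<close>

primrec subst :: "('b, 'c, 'f) trm \<Rightarrow> ('b, 'c, 'f) trm \<Rightarrow> nat \<Rightarrow> ('b, 'c, 'f) trm" where
  "subst (Var i) V k = (if i < k then Var i else if i = k then V else Var (i - 1))"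
| "subst (Const c) V k = Const c"
| "subst (Fn f Ms) V k = Fn f (map (\<lambda>M. subst M V k) Ms)"
| "subst (Cond L M N) V k = Cond (subst L V k) (subst M V k) (subst N V k)"
| "subst (Or M N) V k = Or (subst M V k) (subst N V k)"
| "subst (Rwd N M) V k = Rwd (subst N V k) (subst M V k)"
| "subst (PChoice p M N) V k = PChoice p (subst M V k) (subst N V k)"
| "subst Star V k = Star"
| "subst (MkPair M N) V k = MkPair (subst M V k) (subst N V k)"
| "subst (Fst M) V k = Fst (subst M V k)"
| "subst (Snd M) V k = Snd (subst M V k)"
| "subst (Lam \<sigma> M) V k = Lam \<sigma> (subst M (lift V 0) (Suc k))"
| "subst (App M N) V k = App (subst M V k) (subst N V k)"

text \<open>
  Closedness is not part of \<open>is_value\<close> or of evaluation contexts below: both are only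
  applied inside programs, and evaluation contexts do not bind variables, so it is automatic there.
\<close>

inductive is_value :: "('b, 'c, 'f) trm \<Rightarrow> bool" where
  "is_value (Const c)"
| "is_value Star"
| "\<lbrakk>is_value V; is_value W\<rbrakk> \<Longrightarrow> is_value (MkPair V W)"
| "is_value (Lam \<sigma> M)"

text \<open>
  One-hole contexts.  Only closed terms are ever put in the hole of a context with binders,
  so filling needs no lifting and no question of capture arises.
\<close>

datatype ('b, 'c, 'f) ctx =
    Hole
  | FnC 'f "('b, 'c, 'f) trm list" "('b, 'c, 'f) ctx" "('b, 'c, 'f) trm list"
  | CondC1 "('b, 'c, 'f) ctx" "('b, 'c, 'f) trm" "('b, 'c, 'f) trm"
  | CondC2 "('b, 'c, 'f) trm" "('b, 'c, 'f) ctx" "('b, 'c, 'f) trm"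
  | CondC3 "('b, 'c, 'f) trm" "('b, 'c, 'f) trm" "('b, 'c, 'f) ctx"
  | OrC1 "('b, 'c, 'f) ctx" "('b, 'c, 'f) trm"
  | OrC2 "('b, 'c, 'f) trm" "('b, 'c, 'f) ctx"
  | RwdC1 "('b, 'c, 'f) ctx" "('b, 'c, 'f) trm"
  | RwdC2 "('b, 'c, 'f) trm" "('b, 'c, 'f) ctx"
  | PChoiceC1 real "('b, 'c, 'f) ctx" "('b, 'c, 'f) trm"
  | PChoiceC2 real "('b, 'c, 'f) trm" "('b, 'c, 'f) ctx"
  | PairC1 "('b, 'c, 'f) ctx" "('b, 'c, 'f) trm"
  | PairC2 "('b, 'c, 'f) trm" "('b, 'c, 'f) ctx"
  | FstC "('b, 'c, 'f) ctx"
  | SndC "('b, 'c, 'f) ctx"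
  | LamC "'b ty" "('b, 'c, 'f) ctx"
  | AppC1 "('b, 'c, 'f) ctx" "('b, 'c, 'f) trm"
  | AppC2 "('b, 'c, 'f) trm" "('b, 'c, 'f) ctx"

primrec fill :: "('b, 'c, 'f) ctx \<Rightarrow> ('b, 'c, 'f) trm \<Rightarrow> ('b, 'c, 'f) trm" where
  "fill Hole Q = Q"
| "fill (FnC f Ms C Ns) Q = Fn f (Ms @ fill C Q # Ns)"
| "fill (CondC1 C M N) Q = Cond (fill C Q) M N"
| "fill (CondC2 L C N) Q = Cond L (fill C Q) N"
| "fill (CondC3 L M C) Q = Cond L M (fill C Q)"
| "fill (OrC1 C N) Q = Or (fill C Q) N"
| "fill (OrC2 M C) Q = Or M (fill C Q)"
| "fill (RwdC1 C M) Q = Rwd (fill C Q) M"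
| "fill (RwdC2 N C) Q = Rwd N (fill C Q)"
| "fill (PChoiceC1 p C N) Q = PChoice p (fill C Q) N"
| "fill (PChoiceC2 p M C) Q = PChoice p M (fill C Q)"
| "fill (PairC1 C N) Q = MkPair (fill C Q) N"
| "fill (PairC2 M C) Q = MkPair M (fill C Q)"
| "fill (FstC C) Q = Fst (fill C Q)"
| "fill (SndC C) Q = Snd (fill C Q)"
| "fill (LamC \<sigma> C) Q = Lam \<sigma> (fill C Q)"
| "fill (AppC1 C N) Q = App (fill C Q) N"
| "fill (AppC2 M C) Q = App M (fill C Q)"

inductive eval_ctx :: "('b, 'c, 'f) ctx \<Rightarrow> bool" where
  "eval_ctx Hole"
| "eval_ctx C \<Longrightarrow> eval_ctx (FnC f (map Const cs) C Ms)"
| "eval_ctx C \<Longrightarrow> eval_ctx (CondC1 C M N)"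
| "eval_ctx C \<Longrightarrow> eval_ctx (RwdC1 C M)"
| "eval_ctx C \<Longrightarrow> eval_ctx (PairC1 C N)"
| "\<lbrakk>is_value V; eval_ctx C\<rbrakk> \<Longrightarrow> eval_ctx (PairC2 V C)"
| "eval_ctx C \<Longrightarrow> eval_ctx (FstC C)"
| "eval_ctx C \<Longrightarrow> eval_ctx (SndC C)"
| "eval_ctx C \<Longrightarrow> eval_ctx (AppC1 C N)"
| "eval_ctx C \<Longrightarrow> eval_ctx (AppC2 (Lam \<sigma> M) C)"

inductive redex ::
  "('b, 'c, 'f) lang_sig \<Rightarrow> ('b, 'c, 'f) trm \<Rightarrow> ('b, 'c, 'f) trm \<Rightarrow> bool"
  for S
where
  "map (const_ty S) cs = arg_tys S f \<Longrightarrow> redex S (Fn f (map Const cs)) (Const (fn_val S f cs))"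
| "redex S (Cond (Const (tt_const S)) M N) M"
| "redex S (Cond (Const (ff_const S)) M N) N"
| "\<lbrakk>is_value V; is_value W\<rbrakk> \<Longrightarrow> redex S (Fst (MkPair V W)) V"
| "\<lbrakk>is_value V; is_value W\<rbrakk> \<Longrightarrow> redex S (Snd (MkPair V W)) W"
| "is_value V \<Longrightarrow> redex S (App (Lam \<sigma> M) V) (subst M V 0)"

inductive step ::
  "('b, 'c, 'f) lang_sig \<Rightarrow> ('b, 'c, 'f) trm \<Rightarrow> ('b, 'c, 'f) trm \<Rightarrow> bool"
  for S
where
  "\<lbrakk>eval_ctx C; redex S Q Q'\<rbrakk> \<Longrightarrow> step S (fill C Q) (fill C Q')"

text \<open>Effect values; the argument of \<open>EVal\<close> is meant to be a value.\<close>

datatype ('b, 'c, 'f) effval =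
    EVal "('b, 'c, 'f) trm"
  | EOr "('b, 'c, 'f) effval" "('b, 'c, 'f) effval"
  | ERwd 'c "('b, 'c, 'f) effval"
  | EPChoice real "('b, 'c, 'f) effval" "('b, 'c, 'f) effval"

inductive evaluates ::
  "('b, 'c, 'f) lang_sig \<Rightarrow> ('b, 'c, 'f) trm \<Rightarrow> ('b, 'c, 'f) effval \<Rightarrow> bool"
  for S
where
  "is_value V \<Longrightarrow> evaluates S V (EVal V)"
| "\<lbrakk>step S M M'; evaluates S M' E\<rbrakk> \<Longrightarrow> evaluates S M E"
| "\<lbrakk>eval_ctx C; evaluates S (fill C M\<^sub>1) E\<^sub>1; evaluates S (fill C M\<^sub>2) E\<^sub>2\<rbrakk> \<Longrightarrow>
    evaluates S (fill C (Or M\<^sub>1 M\<^sub>2)) (EOr E\<^sub>1 E\<^sub>2)"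
| "\<lbrakk>eval_ctx C; evaluates S (fill C M\<^sub>1) E\<^sub>1; evaluates S (fill C M\<^sub>2) E\<^sub>2\<rbrakk> \<Longrightarrow>
    evaluates S (fill C (PChoice p M\<^sub>1 M\<^sub>2)) (EPChoice p E\<^sub>1 E\<^sub>2)"
| "\<lbrakk>eval_ctx C; evaluates S (fill C M\<^sub>1) E\<^sub>1\<rbrakk> \<Longrightarrow>
    evaluates S (fill C (Rwd (Const c) M\<^sub>1)) (ERwd c E\<^sub>1)"

text \<open>
  For every program exactly one effect value is related to it (evaluation is deterministic and
  terminating), so the definite description below is meaningful on programs.
\<close>

definition Op :: "('b, 'c, 'f) lang_sig \<Rightarrow> ('b, 'c, 'f) trm \<Rightarrow> ('b, 'c, 'f) effval" where
  "Op S M = (THE E. evaluates S M E)"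

locale barycentric_algebra =
  fixes bary :: "real \<Rightarrow> 'a \<Rightarrow> 'a \<Rightarrow> 'a"
  assumes bary_one: "bary 1 x y = x"
    and bary_idem: "p \<in> {0..1} \<Longrightarrow> bary p x x = x"
    and bary_commute: "p \<in> {0..1} \<Longrightarrow> bary p x y = bary (1 - p) y x"
    and bary_assoc: "\<lbrakk>p \<in> {0..<1}; q \<in> {0..<1}\<rbrakk> \<Longrightarrow>
      bary q (bary p x y) z = bary (p * q) x (bary ((1 - p) * q / (1 - p * q)) y z)"

text \<open>
  The set of rewards is the type \<open>'r\<close>; the commutative monoid and the total order are those
  of its type classes.
\<close>

locale reward_algebra = barycentric_algebra bary
  for bary :: "real \<Rightarrow> 'r::{comm_monoid_add, linorder} \<Rightarrow> 'r \<Rightarrow> 'r" +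
  assumes add_bary: "p \<in> {0..1} \<Longrightarrow> r + bary p s s' = bary p (r + s) (r + s')"
    and le_add_iff: "r \<le> s \<longleftrightarrow> r + t \<le> s + t"
    and le_bary_iff: "p \<in> {0<..<1} \<Longrightarrow> r \<le> s \<longleftrightarrow> bary p r t \<le> bary p s t"
    and bary_add_add: "p \<in> {0..1} \<Longrightarrow>
      bary p (r + x) (s + y) = bary p (bary p r s + x) (bary p r s + y)"

text \<open>
  Convex combinations of a list of weighted points, with weights adding up to one.  If the first
  weight is one, the remaining weights are divided by zero, but then the first point is the result
  whatever the second argument of \<open>b\<close>.
\<close>

function convex_comb :: "(real \<Rightarrow> 'a \<Rightarrow> 'a \<Rightarrow> 'a) \<Rightarrow> (real \<times> 'a) list \<Rightarrow> 'a" where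
  "convex_comb b [] = undefined"
| "convex_comb b [(p, x)] = x"
| "convex_comb b ((p, x) # w # ws) =
    b p x (convex_comb b (map (\<lambda>(q, y). (q / (1 - p), y)) (w # ws)))"
  by pat_completeness auto
termination by (relation "Wellfounded.measure (\<lambda>(b, ws). length ws)") auto

text \<open>
  A common universe for the denotations of all base types: the two truth values, the rewards, and
  the elements of a further arbitrary type.
\<close>

datatype ('r, 'd) den = BoolD bool | RewD (rew_of: 'r) | OtherD 'd

record ('b, 'c, 'f, 'r, 'd) interp =
  bary :: "real \<Rightarrow> 'r \<Rightarrow> 'r \<Rightarrow> 'r"
  base_den :: "'b \<Rightarrow> ('r, 'd) den set"
  const_den :: "'c \<Rightarrow> ('r, 'd) den"
  fn_den :: "'f \<Rightarrow> ('r, 'd) den list \<Rightarrow> ('r, 'd) den"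

locale interpreted_language = language S + reward_algebra "bary I"
  for S :: "('b, 'c, 'f) lang_sig"
    and I :: "('b, 'c, 'f, 'r::{comm_monoid_add, linorder}, 'd) interp" +
  assumes base_den_nonempty: "\<And>b. base_den I b \<noteq> {}"
    and base_den_bool: "base_den I (bool_ty S) = {BoolD False, BoolD True}"
    and base_den_rew: "base_den I (rew_ty S) = range RewD"
    and const_den_in: "\<And>c. const_den I c \<in> base_den I (const_ty S c)"
    and const_den_tt: "const_den I (tt_const S) = BoolD True"
    and const_den_ff: "const_den I (ff_const S) = BoolD False"
    and const_den_zero: "const_den I (zero_const S) = RewD 0"
    and const_den_inj: "\<And>c c'. \<lbrakk>const_ty S c = const_ty S c'; const_den I c = const_den I c'\<rbrakk> \<Longrightarrow> c = c'"
    and const_den_nonzero: "\<exists>c. const_ty S c = rew_ty S \<and> const_den I c \<noteq> RewD 0"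
    and fn_den_in: "\<And>f ds. list_all2 (\<lambda>d b. d \<in> base_den I b) ds (arg_tys S f) \<Longrightarrow>
      fn_den I f ds \<in> base_den I (res_ty S f)"
    and fn_den_plus: "\<And>r s. fn_den I (plus_sym S) [RewD r, RewD s] = RewD (r + s)"
    and fn_den_oplus: "\<And>p r s. p \<in> {0..1} \<Longrightarrow>
      fn_den I (oplus_sym S p) [RewD r, RewD s] = RewD (bary I p r s)"
    and fn_den_le: "\<And>r s. fn_den I (le_sym S) [RewD r, RewD s] = BoolD (r \<le> s)"
    and fn_den_val: "\<And>f cs. map (const_ty S) cs = arg_tys S f \<Longrightarrow>
      fn_den I f (map (const_den I) cs) = const_den I (fn_val S f cs)"

text \<open>
  Elements of \<open>DW(X)\<close> are represented as finitely supported probability mass functions on pairs of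
  a reward and an element of \<open>X\<close>.
\<close>

definition act :: "'r::plus \<Rightarrow> ('r \<times> 'x) pmf \<Rightarrow> ('r \<times> 'x) pmf" where
  "act r \<mu> = map_pmf (\<lambda>(r', x). (r + r', x)) \<mu>"

definition mix :: "real \<Rightarrow> 'x pmf \<Rightarrow> 'x pmf \<Rightarrow> 'x pmf" where
  "mix p \<mu> \<nu> = bind_pmf (bernoulli_pmf p) (\<lambda>h. if h then \<mu> else \<nu>)"

text \<open>
  Expected reward: the convex combination over any enumeration of the (finite) support.  By the
  barycentric axioms the result does not depend on the enumeration.
\<close>

definition expected_reward :: "(real \<Rightarrow> 'r \<Rightarrow> 'r \<Rightarrow> 'r) \<Rightarrow> ('r \<times> 'x) pmf \<Rightarrow> 'r" where
  "expected_reward b \<mu> =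
    (let rxs = (SOME rxs. distinct rxs \<and> set rxs = set_pmf \<mu>)
     in convex_comb b (map (\<lambda>rx. (pmf \<mu> rx, fst rx)) rxs))"

definition VDis :: "('r \<times> 'x) pmf \<Rightarrow> 'x pmf" where
  "VDis \<mu> = map_pmf snd \<mu>"

datatype strat = StratVal | StratL strat | StratR strat | StratPair strat strat

primrec Str :: "('b, 'c, 'f) effval \<Rightarrow> strat set" where
  "Str (EVal V) = {StratVal}"
| "Str (EOr E\<^sub>1 E\<^sub>2) = StratL ` Str E\<^sub>1 \<union> StratR ` Str E\<^sub>2"
| "Str (ERwd c E) = Str E"
| "Str (EPChoice p E\<^sub>1 E\<^sub>2) = {StratPair s\<^sub>1 s\<^sub>2 | s\<^sub>1 s\<^sub>2. s\<^sub>1 \<in> Str E\<^sub>1 \<and> s\<^sub>2 \<in> Str E\<^sub>2}"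

text \<open>
  The order on strategies does not refer to the effect value, since it is determined by the shape
  of the strategies alone; it is total on each \<open>Str E\<close>.
\<close>

inductive strat_less :: "strat \<Rightarrow> strat \<Rightarrow> bool" where
  "strat_less (StratL s) (StratR t)"
| "strat_less s t \<Longrightarrow> strat_less (StratL s) (StratL t)"
| "strat_less s t \<Longrightarrow> strat_less (StratR s) (StratR t)"
| "strat_less s\<^sub>1 t\<^sub>1 \<Longrightarrow> strat_less (StratPair s\<^sub>1 s\<^sub>2) (StratPair t\<^sub>1 t\<^sub>2)"
| "strat_less s\<^sub>2 t\<^sub>2 \<Longrightarrow> strat_less (StratPair s s\<^sub>2) (StratPair s t\<^sub>2)"

text \<open>\<open>Out I s E\<close> is meaningful for \<open>s \<in> Str E\<close> only.\<close>

primrec Out ::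
  "('b, 'c, 'f, 'r::{comm_monoid_add, linorder}, 'd) interp \<Rightarrow> ('b, 'c, 'f) effval \<Rightarrow> strat \<Rightarrow>
    ('r \<times> ('b, 'c, 'f) trm) pmf"
where
  "Out I (EVal V) s = return_pmf (0, V)"
| "Out I (EOr E\<^sub>1 E\<^sub>2) s =
    (case s of StratL s' \<Rightarrow> Out I E\<^sub>1 s' | StratR s' \<Rightarrow> Out I E\<^sub>2 s' | _ \<Rightarrow> undefined)"
| "Out I (ERwd c E) s = act (rew_of (const_den I c)) (Out I E s)"
| "Out I (EPChoice p E\<^sub>1 E\<^sub>2) s =
    (case s of StratPair s\<^sub>1 s\<^sub>2 \<Rightarrow> mix p (Out I E\<^sub>1 s\<^sub>1) (Out I E\<^sub>2 s\<^sub>2) | _ \<Rightarrow> undefined)"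

definition Rew ::
  "('b, 'c, 'f, 'r::{comm_monoid_add, linorder}, 'd) interp \<Rightarrow> ('b, 'c, 'f) effval \<Rightarrow> strat \<Rightarrow> 'r"
where
  "Rew I E s = expected_reward (bary I) (Out I E s)"

definition maximizing ::
  "('b, 'c, 'f, 'r::{comm_monoid_add, linorder}, 'd) interp \<Rightarrow> ('b, 'c, 'f) effval \<Rightarrow> strat \<Rightarrow> bool"
where
  "maximizing I E s \<longleftrightarrow> s \<in> Str E \<and> (\<forall>t \<in> Str E. Rew I E t \<le> Rew I E s)"

definition s_opt ::
  "('b, 'c, 'f, 'r::{comm_monoid_add, linorder}, 'd) interp \<Rightarrow> ('b, 'c, 'f) effval \<Rightarrow> strat"
where
  "s_opt I E = (THE s. maximizing I E s \<and> (\<forall>t. maximizing I E t \<longrightarrow> s = t \<or> strat_less s t))"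

definition Op_s ::
  "('b, 'c, 'f) lang_sig \<Rightarrow> ('b, 'c, 'f, 'r::{comm_monoid_add, linorder}, 'd) interp \<Rightarrow>
    ('b, 'c, 'f) trm \<Rightarrow> ('r \<times> ('b, 'c, 'f) trm) pmf"
where
  "Op_s S I M = Out I (Op S M) (s_opt I (Op S M))"

definition obs_equiv ::
  "('b, 'c, 'f) lang_sig \<Rightarrow> (('b, 'c, 'f) trm \<Rightarrow> 'o) \<Rightarrow> 'b ty \<Rightarrow>
    ('b, 'c, 'f) trm \<Rightarrow> ('b, 'c, 'f) trm \<Rightarrow> bool"
where
  "obs_equiv S Ob \<sigma> M N \<longleftrightarrow>
    (\<forall>C. (\<forall>L. program S L \<sigma> \<longrightarrow> program S (fill C L) (Base (bool_ty S))) \<longrightarrow>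
      Ob (fill C M) = Ob (fill C N))"

definition Ob_VDis ::
  "('b, 'c, 'f) lang_sig \<Rightarrow> ('b, 'c, 'f, 'r::{comm_monoid_add, linorder}, 'd) interp \<Rightarrow>
    ('b, 'c, 'f) trm \<Rightarrow> ('b, 'c, 'f) trm pmf"
where
  "Ob_VDis S I M = VDis (Op_s S I M)"

definition Ob_T3 ::
  "('b, 'c, 'f) lang_sig \<Rightarrow> ('b, 'c, 'f, 'r::{comm_monoid_add, linorder}, 'd) interp \<Rightarrow>
    ('b, 'c, 'f) trm \<Rightarrow> ('b, 'c, 'f) trm pmf \<times> 'r"
where
  "Ob_T3 S I M = (VDis (Op_s S I M), expected_reward (bary I) (Op_s S I M))"

end

theory Submission
  imports Defs
begin

text \<open>
  Rewards are denotable: \<open>+\<close> and \<open>\<oplus>\<^sub>p\<close> are function symbols whose values are constants,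
  so the expected reward of a Boolean program \<open>P\<close> is the denotation of some constant \<open>c\<close>.
  If \<open>P\<close> and \<open>Q\<close> have the same value distribution but the expected reward of \<open>Q\<close> is larger,
  pick a truth value \<open>V\<close> such that this distribution is not concentrated at \<open>V\<close>.
  In \<open>(c \<cdot> V) or P\<close> there is a tie, resolved to the left with result \<open>V\<close>, whereas \<open>(c \<cdot> V) or Q\<close>
  makes the right choice and behaves as \<open>Q\<close>. So the value distributions differ.

  Since \<open>Op\<close> is a definite description, this needs that evaluation is deterministic (unique
  decomposition into evaluation context and active term) and terminating (a logical relation).
\<close>

section \<open>Determinism\<close>

text \<open>One clause for each rule of \<open>evaluates\<close> other than the value rule: these
  are the terms on which such a rule acts inside an evaluation context.\<close>

inductive active :: "('b, 'c, 'f) lang_sig \<Rightarrow> ('b, 'c, 'f) trm \<Rightarrow> bool" for S where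
  "redex S Q Q' \<Longrightarrow> active S Q"
| "active S (Or M N)"
| "active S (PChoice p M N)"
| "active S (Rwd (Const c) M)"

inductive_simps is_value_simps [simp]:
  "is_value (Var i)" "is_value (Const c)" "is_value (Fn f Ms)" "is_value (Cond L M N)" "is_value (Or M N)"
  "is_value (Rwd N M)" "is_value (PChoice p M N)" "is_value (MkPair M N)" "is_value (Fst M)"
  "is_value (Snd M)" "is_value (Lam \<sigma> M)" "is_value (App M N)"

inductive_simps redex_simps [simp]:
  "redex S (Var i) Q" "redex S (Const c) Q" "redex S (Fn f Ms) Q"
  "redex S (Cond L M N) Q" "redex S (Or M N) Q"
  "redex S (Rwd N M) Q" "redex S (PChoice p M N) Q" "redex S Star Q" "redex S (MkPair M N) Q"
  "redex S (Fst M) Q" "redex S (Snd M) Q" "redex S (Lam \<sigma> M) Q" "redex S (App M N) Q"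

inductive_simps active_simps [simp]:
  "active S (Var i)" "active S (Const c)" "active S (Fn f Ms)" "active S (Cond L M N)" "active S (Or M N)"
  "active S (Rwd N M)" "active S (PChoice p M N)" "active S Star" "active S (MkPair M N)"
  "active S (Fst M)" "active S (Snd M)" "active S (Lam \<sigma> M)" "active S (App M N)"

text \<open>Pairs are the only values with evaluation positions inside, and there the non-value in
  the hole spoils the pair; every other frame builds a non-value outright.\<close>

lemma fill_active_not_value:
  assumes "eval_ctx C" and "active S Q"
  shows "\<not> is_value (fill C Q)"
  using assms(1)
proof (induction rule: eval_ctx.induct)
  case 1
  then show ?case using assms(2) by (cases Q) auto
qed auto

lemma fill_active_not_Const:
  assumes "eval_ctx C" and "active S Q"
  shows "fill C Q \<noteq> Const c"
  using fill_active_not_value[OF assms] by auto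

lemma fill_active_not_Lam:
  assumes "eval_ctx C" and "active S Q"
  shows "fill C Q \<noteq> Lam \<sigma> M"
  using fill_active_not_value[OF assms] by auto

text \<open>The hole of a function frame sits at the first argument that is not a constant, so the
  argument list determines its position.\<close>

lemma map_Const_append_Cons_eq:
  assumes "map Const cs @ x # xs = map Const ds @ y # ys"
    and "\<And>c. x \<noteq> Const c" and "\<And>c. y \<noteq> Const c"
  shows "cs = ds \<and> x = y \<and> xs = ys"
  using assms
proof (induction cs arbitrary: ds)
  case Nil
  then show ?case by (cases ds) auto
next
  case (Cons c cs)
  then show ?case by (cases ds) auto
qed

lemma map_Const_neq_append_Cons:
  assumes "\<And>c. x \<noteq> Const c"
  shows "map Const cs \<noteq> xs @ x # ys" "xs @ x # ys \<noteq> map Const cs"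
  using assms by (metis in_set_conv_decomp ex_map_conv)+

text \<open>In an active term all evaluation positions already hold values of the required form,
  whereas a context filled with an active term never is one.\<close>

lemma active_fill_active:
  assumes "active S (fill D R)" and "eval_ctx D" and "active S R"
  shows "D = Hole"
  using assms(2)
proof cases
  case (2 C f cs Ms)
  then show ?thesis
    using assms(1) map_Const_neq_append_Cons[OF fill_active_not_Const[OF 2(2) assms(3)]] by auto
next
  case (3 C M N)
  then show ?thesis using assms(1) fill_active_not_Const[OF 3(2) assms(3)] by auto
next
  case (4 C M)
  then show ?thesis using assms(1) fill_active_not_Const[OF 4(2) assms(3)] by auto
next
  case (7 C)
  then show ?thesis using assms(1) fill_active_not_value[OF 7(2) assms(3)] by auto
next
  case (8 C)
  then show ?thesis using assms(1) fill_active_not_value[OF 8(2) assms(3)] by auto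
next
  case (9 C N)
  then show ?thesis using assms(1) fill_active_not_Lam[OF 9(2) assms(3)] by auto
next
  case (10 C \<sigma> M)
  then show ?thesis using assms(1) fill_active_not_value[OF 10(2) assms(3)] by auto
qed (use assms(1) in auto)

lemma fill_eq_Hole_iff:
  assumes "eval_ctx C" and "eval_ctx D" and "active S Q" and "active S R"
    and "fill C Q = fill D R"
  shows "C = Hole \<longleftrightarrow> D = Hole"
  using assms active_fill_active by (metis fill.simps(1))

text \<open>The head constructor of the term, together with which subterms are values (for
  applications, abstractions), forces the outermost frame; the induction hypothesis handles the
  rest.\<close>

lemma unique_decomposition:
  assumes "eval_ctx C" and "eval_ctx D" and "active S Q" and "active S R"
    and "fill C Q = fill D R"
  shows "C = D \<and> Q = R"
  using assms(1,2,5)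
proof (induction arbitrary: D rule: eval_ctx.induct)
  case 1
  then show ?case
    using fill_eq_Hole_iff[OF eval_ctx.intros(1) _ assms(3,4)] by fastforce
next
  case (2 C f cs Ms)
  \<comment> \<open>With the hole excluded, \<open>D\<close> has an outermost frame to compare with
    that of the other context; the later cases start in the same way.\<close>
  have "D \<noteq> Hole"
    using fill_eq_Hole_iff[OF eval_ctx.intros(2)[OF "2.hyps"] "2.prems"(1) assms(3,4) "2.prems"(2)] by simp
  with "2.prems"(1) show ?case
  proof cases
    case (2 D' g ds Ns)
    have "cs = ds \<and> fill C Q = fill D' R \<and> Ms = Ns"
      using 2 \<open>fill (FnC f (map Const cs) C Ms) Q = fill D R\<close>
        fill_active_not_Const[OF \<open>eval_ctx C\<close> assms(3)] fill_active_not_Const[OF 2(2) assms(4)]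
      by (intro map_Const_append_Cons_eq) auto
    then show ?thesis
      using 2 \<open>fill (FnC f (map Const cs) C Ms) Q = fill D R\<close>
        \<open>\<And>D. eval_ctx D \<Longrightarrow> fill C Q = fill D R \<Longrightarrow> C = D \<and> Q = R\<close> by simp
  qed (use 2 in auto)
next
  case (3 C M N)
  have "D \<noteq> Hole"
    using fill_eq_Hole_iff[OF eval_ctx.intros(3)[OF "3.hyps"] "3.prems"(1) assms(3,4) "3.prems"(2)] by simp
  with "3.prems"(1) show ?case
    by cases (use "3.IH" "3.prems"(2) in auto)
next
  case (4 C M)
  have "D \<noteq> Hole"
    using fill_eq_Hole_iff[OF eval_ctx.intros(4)[OF "4.hyps"] "4.prems"(1) assms(3,4) "4.prems"(2)] by simp
  with "4.prems"(1) show ?case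
    by cases (use "4.IH" "4.prems"(2) in auto)
next
  case (5 C N)
  have "D \<noteq> Hole"
    using fill_eq_Hole_iff[OF eval_ctx.intros(5)[OF "5.hyps"] "5.prems"(1) assms(3,4) "5.prems"(2)] by simp
  with "5.prems"(1) show ?case
    by cases (use "5.IH" "5.prems"(2) fill_active_not_value[OF "5.hyps" assms(3)] in auto)
next
  case (6 V C)
  have "D \<noteq> Hole"
    using fill_eq_Hole_iff[OF eval_ctx.intros(6)[OF "6.hyps"(1,2)] "6.prems"(1) assms(3,4) "6.prems"(2)] by simp
  with "6.prems"(1) show ?case
    by cases (use "6.IH" "6.prems"(2) "6.hyps"(1) fill_active_not_value[OF _ assms(4)] in auto)
next
  case (7 C)
  have "D \<noteq> Hole"
    using fill_eq_Hole_iff[OF eval_ctx.intros(7)[OF "7.hyps"] "7.prems"(1) assms(3,4) "7.prems"(2)] by simp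
  with "7.prems"(1) show ?case
    by cases (use "7.IH" "7.prems"(2) in auto)
next
  case (8 C)
  have "D \<noteq> Hole"
    using fill_eq_Hole_iff[OF eval_ctx.intros(8)[OF "8.hyps"] "8.prems"(1) assms(3,4) "8.prems"(2)] by simp
  with "8.prems"(1) show ?case
    by cases (use "8.IH" "8.prems"(2) in auto)
next
  case (9 C N)
  have "D \<noteq> Hole"
    using fill_eq_Hole_iff[OF eval_ctx.intros(9)[OF "9.hyps"] "9.prems"(1) assms(3,4) "9.prems"(2)] by simp
  with "9.prems"(1) show ?case
    by cases (use "9.IH" "9.prems"(2) fill_active_not_Lam[OF "9.hyps" assms(3)] in auto)
next
  case (10 C \<sigma> M)
  have "D \<noteq> Hole"
    using fill_eq_Hole_iff[OF eval_ctx.intros(10)[OF "10.hyps"] "10.prems"(1) assms(3,4) "10.prems"(2)] by simp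
  with "10.prems"(1) show ?case
    by cases (use "10.IH" "10.prems"(2) fill_active_not_Lam[OF _ assms(4), symmetric] in auto)
qed

lemma inj_map_Const: "map Const cs = map Const ds \<longleftrightarrow> cs = ds"
  by (simp add: inj_map_eq_map inj_def)

context interpreted_language
begin

text \<open>The distinctness comes from the denotations; it keeps the two rules for conditionals
  from overlapping.\<close>

lemma tt_neq_ff: "tt_const S \<noteq> ff_const S"
  using const_den_tt const_den_ff by auto

lemma redex_deterministic:
  assumes "redex S Q Q1" and "redex S Q Q2"
  shows "Q1 = Q2"
  using assms tt_neq_ff by (auto elim!: redex.cases simp: inj_map_Const)

text \<open>Inversion: by unique decomposition, the last rule of the derivation must act on
  \<open>Q\<close> in \<open>C\<close> and nowhere else.\<close>

lemma evaluates_fill_active: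
  assumes "evaluates S (fill C Q) E" and C: "eval_ctx C" and Q: "active S Q"
  obtains Q' where "redex S Q Q'" and "evaluates S (fill C Q') E"
  | M N E1 E2 where "Q = Or M N" and "E = EOr E1 E2"
      and "evaluates S (fill C M) E1" and "evaluates S (fill C N) E2"
  | p M N E1 E2 where "Q = PChoice p M N" and "E = EPChoice p E1 E2"
      and "evaluates S (fill C M) E1" and "evaluates S (fill C N) E2"
  | c M E1 where "Q = Rwd (Const c) M" and "E = ERwd c E1" and "evaluates S (fill C M) E1"
  using assms(1)
proof cases
  case 1
  then show ?thesis using fill_active_not_value[OF C Q] by simp
next
  case (2 M')
  from 2(1) obtain D R R' where D: "eval_ctx D" "redex S R R'" "fill C Q = fill D R" "M' = fill D R'"
    by (auto elim: step.cases)
  then have "C = D \<and> Q = R"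
    using unique_decomposition[OF C D(1) Q active.intros(1)[OF D(2)] D(3)] by simp
  then show ?thesis using D 2 that(1) by blast
next
  case (3 D M N E1 E2)
  then show ?thesis using that(2) unique_decomposition[OF C 3(3) Q active.intros(2) 3(1)] by auto
next
  case (4 D M N E1 E2 p)
  then show ?thesis using that(3) unique_decomposition[OF C 4(3) Q active.intros(3) 4(1)] by auto
next
  case (5 D M E1 c)
  then show ?thesis using that(4) unique_decomposition[OF C 5(3) Q active.intros(4) 5(1)] by auto
qed

text \<open>Each non-value rule of the first derivation exhibits an active term, at which inversion
  forces the second derivation to use the same rule.\<close>

lemma evaluates_deterministic:
  assumes "evaluates S M E" and "evaluates S M E'"
  shows "E = E'"
  using assms
proof (induction arbitrary: E' rule: evaluates.induct)
  case (1 V)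
  \<comment> \<open>Every rule but the first concerns a context filled with an active term, which is
    not a value.\<close>
  have not_fill: "V \<noteq> fill C Q" if "eval_ctx C" "active S Q" for C Q
    using fill_active_not_value[OF that] 1(1) by auto
  then have "\<not> step S V V'" for V'
    by (metis step.cases active.intros(1))
  with 1(2) show ?case
    by cases (use not_fill in auto)
next
  case (2 M M' E)
  from 2(1) obtain C Q Q' where C: "eval_ctx C" "redex S Q Q'" "M = fill C Q" "M' = fill C Q'"
    by (auto elim: step.cases)
  from 2(4)[unfolded C(3)] C(1) active.intros(1)[OF C(2)] show ?case
  proof (cases rule: evaluates_fill_active)
    case (1 Q'')
    then show ?thesis using redex_deterministic[OF C(2)] 2(3) C(4) by simp
  qed (use C(2) in auto)
next
  case (3 C M1 E1 M2 E2)
  from 3(6,1) active.intros(2) show ?case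
    by (cases rule: evaluates_fill_active) (auto intro: 3)
next
  case (4 C M1 E1 M2 E2 p)
  from 4(6,1) active.intros(3) show ?case
    by (cases rule: evaluates_fill_active) (auto intro: 4)
next
  case (5 C M1 E1 c)
  from 5(4,1) active.intros(4) show ?case
    by (cases rule: evaluates_fill_active) (auto intro: 5)
qed

lemma Op_eq:
  assumes "evaluates S M E" shows "Op S M = E"
  unfolding Op_def using assms evaluates_deterministic by blast

end

section \<open>Termination\<close>

text \<open>This lets a step or an effect inside \<open>M\<close> count as one of
  \<open>fill C M\<close>.\<close>

lemma eval_ctx_compose:
  assumes "eval_ctx C" and "eval_ctx D"
  obtains C' where "eval_ctx C'" and "\<And>Q. fill C' Q = fill C (fill D Q)"
proof -
  have "\<exists>C'. eval_ctx C' \<and> (\<forall>Q. fill C' Q = fill C (fill D Q))"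
    using assms
  proof (induction rule: eval_ctx.induct)
    case 1
    then show ?case by auto
  next
    case (2 C f cs Ms)
    then obtain C' where "eval_ctx C'" "\<forall>Q. fill C' Q = fill C (fill D Q)" by auto
    then show ?case by (intro exI[of _ "FnC f (map Const cs) C' Ms"]) (auto intro: eval_ctx.intros)
  next
    case (3 C M N)
    then obtain C' where "eval_ctx C'" "\<forall>Q. fill C' Q = fill C (fill D Q)" by auto
    then show ?case by (intro exI[of _ "CondC1 C' M N"]) (auto intro: eval_ctx.intros)
  next
    case (4 C M)
    then obtain C' where "eval_ctx C'" "\<forall>Q. fill C' Q = fill C (fill D Q)" by auto
    then show ?case by (intro exI[of _ "RwdC1 C' M"]) (auto intro: eval_ctx.intros)
  next
    case (5 C N)
    then obtain C' where "eval_ctx C'" "\<forall>Q. fill C' Q = fill C (fill D Q)" by auto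
    then show ?case by (intro exI[of _ "PairC1 C' N"]) (auto intro: eval_ctx.intros)
  next
    case (6 V C)
    then obtain C' where "eval_ctx C'" "\<forall>Q. fill C' Q = fill C (fill D Q)" by auto
    with 6 show ?case by (intro exI[of _ "PairC2 V C'"]) (auto intro: eval_ctx.intros)
  next
    case (7 C)
    then obtain C' where "eval_ctx C'" "\<forall>Q. fill C' Q = fill C (fill D Q)" by auto
    then show ?case by (intro exI[of _ "FstC C'"]) (auto intro: eval_ctx.intros)
  next
    case (8 C)
    then obtain C' where "eval_ctx C'" "\<forall>Q. fill C' Q = fill C (fill D Q)" by auto
    then show ?case by (intro exI[of _ "SndC C'"]) (auto intro: eval_ctx.intros)
  next
    case (9 C N)
    then obtain C' where "eval_ctx C'" "\<forall>Q. fill C' Q = fill C (fill D Q)" by auto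
    then show ?case by (intro exI[of _ "AppC1 C' N"]) (auto intro: eval_ctx.intros)
  next
    case (10 C \<sigma> M)
    then obtain C' where "eval_ctx C'" "\<forall>Q. fill C' Q = fill C (fill D Q)" by auto
    then show ?case by (intro exI[of _ "AppC2 (Lam \<sigma> M) C'"]) (auto intro: eval_ctx.intros)
  qed
  then show ?thesis using that by auto
qed

lemma step_fill:
  assumes "eval_ctx C" and "step S M M'"
  shows "step S (fill C M) (fill C M')"
  using assms(2)
proof cases
  case (1 D Q Q')
  then show ?thesis
    using eval_ctx_compose[OF assms(1) 1(3)] step.intros[of _ S Q Q'] by metis
qed

text \<open>
  The terms substituted by \<open>psubst\<close> are meant to be closed, hence are not lifted under binders.
\<close>

definition closed_trm :: "('b, 'c, 'f) trm \<Rightarrow> bool" where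
  "closed_trm M \<longleftrightarrow> (\<forall>k. lift M k = M) \<and> (\<forall>k V. subst M V k = M)"

primrec psubst :: "('b, 'c, 'f) trm \<Rightarrow> (nat \<Rightarrow> ('b, 'c, 'f) trm) \<Rightarrow> nat \<Rightarrow> ('b, 'c, 'f) trm" where
  "psubst (Var i) \<theta> k = (if i < k then Var i else \<theta> (i - k))"
| "psubst (Const c) \<theta> k = Const c"
| "psubst (Fn f Ms) \<theta> k = Fn f (map (\<lambda>M. psubst M \<theta> k) Ms)"
| "psubst (Cond L M N) \<theta> k = Cond (psubst L \<theta> k) (psubst M \<theta> k) (psubst N \<theta> k)"
| "psubst (Or M N) \<theta> k = Or (psubst M \<theta> k) (psubst N \<theta> k)"
| "psubst (Rwd N M) \<theta> k = Rwd (psubst N \<theta> k) (psubst M \<theta> k)"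
| "psubst (PChoice p M N) \<theta> k = PChoice p (psubst M \<theta> k) (psubst N \<theta> k)"
| "psubst Star \<theta> k = Star"
| "psubst (MkPair M N) \<theta> k = MkPair (psubst M \<theta> k) (psubst N \<theta> k)"
| "psubst (Fst M) \<theta> k = Fst (psubst M \<theta> k)"
| "psubst (Snd M) \<theta> k = Snd (psubst M \<theta> k)"
| "psubst (Lam \<sigma> M) \<theta> k = Lam \<sigma> (psubst M \<theta> (Suc k))"
| "psubst (App M N) \<theta> k = App (psubst M \<theta> k) (psubst N \<theta> k)"

text \<open>\<open>closed_trm\<close> records just the invariance under \<open>lift\<close> and
  \<open>subst\<close> that substitution needs. At depth \<open>k\<close> the result has only
  indices below \<open>k\<close> left, so nothing changes at any \<open>j\<close> with
  \<open>k \<le> j\<close>; the claim is the case \<open>k = 0\<close>.\<close>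

lemma closed_psubst:
  assumes "\<And>i. closed_trm (\<theta> i)"
  shows "closed_trm (psubst M \<theta> 0)"
proof -
  have "lift (psubst M \<theta> k) j = psubst M \<theta> k" if "k \<le> j" for k j
    using that assms by (induction M arbitrary: k j) (auto simp: closed_trm_def)
  moreover have "subst (psubst M \<theta> k) V j = psubst M \<theta> k" if "k \<le> j" for k j V
    using that assms by (induction M arbitrary: k j V) (auto simp: closed_trm_def)
  ultimately show ?thesis by (simp add: closed_trm_def)
qed

text \<open>Connects the beta rule with environments: contracting a redex prepends the argument to
  the environment under which the body is read.\<close>

lemma subst_psubst:
  assumes "\<And>i. closed_trm (\<theta> i)" and "closed_trm V"
  shows "subst (psubst M \<theta> (Suc k)) V k = psubst M (case_nat V \<theta>) k"
  using assms
proof (induction M arbitrary: k)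
  case (Var i)
  \<comment> \<open>Locally bound index, the index replaced by \<open>V\<close>, or entry
    \<open>j\<close> of \<open>\<theta>\<close>, which is closed and so survives the
    substitution.\<close>
  consider "i < k" | "i = k" | j where "i = Suc (k + j)"
    using less_iff_Suc_add by (metis nat_neq_iff)
  then show ?case by cases (use Var in \<open>auto simp: closed_trm_def\<close>)
qed (auto simp: closed_trm_def)

lemma psubst_typed:
  assumes "typing S \<Gamma> M \<sigma>" and "length \<Gamma> \<le> k"
  shows "psubst M \<theta> k = M"
  using assms
proof (induction arbitrary: k rule: typing.induct)
  case (Fn \<Gamma> Ms f)
  then show ?case
    by (auto simp: list_all2_conv_all_nth intro: nth_equalityI)
qed auto

section \<open>The logical relation\<close>

primrec eff_ok :: "('c \<Rightarrow> bool) \<Rightarrow> (('b, 'c, 'f) trm \<Rightarrow> bool) \<Rightarrow> ('b, 'c, 'f) effval \<Rightarrow> bool" where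
  "eff_ok R P (EVal V) = P V"
| "eff_ok R P (EOr E\<^sub>1 E\<^sub>2) = (eff_ok R P E\<^sub>1 \<and> eff_ok R P E\<^sub>2)"
| "eff_ok R P (ERwd c E) = (R c \<and> eff_ok R P E)"
| "eff_ok R P (EPChoice p E\<^sub>1 E\<^sub>2) = (eff_ok R P E\<^sub>1 \<and> eff_ok R P E\<^sub>2)"

text \<open>Lifts a predicate on values to terms. The typing of the reward constants is carried
  along for the later proof that outcome rewards are denotable.\<close>

definition terminates ::
  "('b, 'c, 'f) lang_sig \<Rightarrow> (('b, 'c, 'f) trm \<Rightarrow> bool) \<Rightarrow> ('b, 'c, 'f) trm \<Rightarrow> bool" where
  "terminates S P M \<longleftrightarrow> (\<exists>E. evaluates S M E \<and> eff_ok (\<lambda>c. const_ty S c = rew_ty S) P E)"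

text \<open>Reducibility in the style of Tait, for values. The function clause demands closedness
  because reducible values become entries of environments.\<close>

primrec red :: "('b, 'c, 'f) lang_sig \<Rightarrow> 'b ty \<Rightarrow> ('b, 'c, 'f) trm \<Rightarrow> bool" where
  "red S (Base b) = (\<lambda>V. \<exists>c. V = Const c \<and> const_ty S c = b)"
| "red S UnitT = (\<lambda>V. V = Star)"
| "red S (ProdT \<sigma> \<tau>) = (\<lambda>V. \<exists>V1 V2. V = MkPair V1 V2 \<and> red S \<sigma> V1 \<and> red S \<tau> V2)"
| "red S (FunT \<sigma> \<tau>) = (\<lambda>V. \<exists>M. V = Lam \<sigma> M \<and> closed_trm V \<and>
    (\<forall>W. red S \<sigma> W \<longrightarrow> terminates S (red S \<tau>) (subst M W 0)))"

lemma red_closed_value: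
  assumes "red S \<sigma> V"
  shows "is_value V \<and> closed_trm V"
  using assms
  by (induction \<sigma> arbitrary: V) (fastforce simp: closed_trm_def intro: is_value.intros)+

lemma terminates_value:
  assumes "red S \<sigma> V"
  shows "terminates S (red S \<sigma>) V"
  using assms red_closed_value[OF assms] unfolding terminates_def
  by (auto intro!: exI[of _ "EVal V"] evaluates.intros(1))

lemma terminates_step:
  assumes "step S M M'" and "terminates S P M'"
  shows "terminates S P M"
  using assms evaluates.intros(2) unfolding terminates_def by blast

lemma terminates_redex:
  assumes "redex S M M'" and "terminates S P M'"
  shows "terminates S P M"
  using step.intros[OF eval_ctx.intros(1) assms(1)] terminates_step assms(2) by fastforce

lemma terminates_Or:
  assumes "eval_ctx C" and "terminates S P (fill C M)" and "terminates S P (fill C N)"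
  shows "terminates S P (fill C (Or M N))"
  using assms evaluates.intros(3) unfolding terminates_def by fastforce

lemma terminates_PChoice:
  assumes "eval_ctx C" and "terminates S P (fill C M)" and "terminates S P (fill C N)"
  shows "terminates S P (fill C (PChoice p M N))"
  using assms evaluates.intros(4) unfolding terminates_def by fastforce

lemma terminates_Rwd:
  assumes "eval_ctx C" and "const_ty S c = rew_ty S" and "terminates S P (fill C M)"
  shows "terminates S P (fill C (Rwd (Const c) M))"
  using assms evaluates.intros(5) unfolding terminates_def by fastforce

text \<open>The evaluation of \<open>M\<close> is replayed inside \<open>C\<close>, using composed
  contexts for its effects; at each leaf, a value satisfying \<open>P\<close>, the last hypothesis
  takes over.\<close>

lemma terminates_fill:
  assumes "terminates S P M" and C: "eval_ctx C"
    and P: "\<And>V. P V \<Longrightarrow> terminates S Q (fill C V)"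
  shows "terminates S Q (fill C M)"
proof -
  obtain E where "evaluates S M E" "eff_ok (\<lambda>c. const_ty S c = rew_ty S) P E"
    using assms(1) unfolding terminates_def by auto
  then show ?thesis
  proof (induction rule: evaluates.induct)
    case (1 V)
    then show ?case using P by auto
  next
    case (2 M M' E)
    then show ?case using terminates_step step_fill[OF C] by metis
  next
    case (3 D M\<^sub>1 E\<^sub>1 M\<^sub>2 E\<^sub>2)
    obtain C' where "eval_ctx C'" "\<And>Q. fill C' Q = fill C (fill D Q)"
      using eval_ctx_compose[OF C 3(1)] by blast
    then show ?case using 3 terminates_Or[of C' S Q M\<^sub>1 M\<^sub>2] by simp
  next
    case (4 D M\<^sub>1 E\<^sub>1 M\<^sub>2 E\<^sub>2 p)
    obtain C' where "eval_ctx C'" "\<And>Q. fill C' Q = fill C (fill D Q)"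
      using eval_ctx_compose[OF C 4(1)] by blast
    then show ?case using 4 terminates_PChoice[of C' S Q M\<^sub>1 M\<^sub>2] by simp
  next
    case (5 D M\<^sub>1 E\<^sub>1 c)
    obtain C' where "eval_ctx C'" "\<And>Q. fill C' Q = fill C (fill D Q)"
      using eval_ctx_compose[OF C 5(1)] by blast
    then show ?case using 5 terminates_Rwd[of C' S c Q M\<^sub>1] by simp
  qed
qed

section \<open>Reducibility of well-typed terms\<close>

context interpreted_language
begin

text \<open>Only two denotations are possible and constants of one type are determined by theirs;
  hence a conditional on a Boolean constant is never stuck.\<close>

lemma bool_const:
  assumes "const_ty S c = bool_ty S"
  shows "c = tt_const S \<or> c = ff_const S"
proof -
  have "const_den I c \<in> {BoolD False, BoolD True}"
    using const_den_in[of c] assms base_den_bool by simp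
  then show ?thesis
    using const_den_inj[of c] assms tt_ty ff_ty const_den_tt const_den_ff by auto
qed

text \<open>Arguments are evaluated from left to right: \<open>cs\<close> collects those already
  evaluated, and the induction runs over the remaining ones.\<close>

lemma terminates_Fn:
  assumes "list_all2 (\<lambda>M b. terminates S (red S (Base b)) M) Ms bs"
    and "map (const_ty S) cs @ bs = arg_tys S f"
  shows "terminates S (red S (Base (res_ty S f))) (Fn f (map Const cs @ Ms))"
  using assms
proof (induction arbitrary: cs rule: list_all2_induct)
  case Nil
  then show ?case
    using terminates_redex[OF redex.intros(1)[of S cs f]]
      terminates_value[of S "Base (res_ty S f)" "Const (fn_val S f cs)"] fn_val_ty by simp
next
  case (Cons M Ms b bs)
  have "terminates S (red S (Base (res_ty S f))) (fill (FnC f (map Const cs) Hole Ms) M)"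
  proof (rule terminates_fill[OF Cons(1)])
    show "eval_ctx (FnC f (map Const cs) Hole Ms)" by (intro eval_ctx.intros)
    fix V assume "red S (Base b) V"
    then obtain c where "V = Const c" "const_ty S c = b" by auto
    then show "terminates S (red S (Base (res_ty S f))) (fill (FnC f (map Const cs) Hole Ms) V)"
      using Cons.IH[of "cs @ [c]"] Cons.prems by simp
  qed
  then show ?case by simp
qed

text \<open>Fundamental lemma of the logical relation, generalised to open terms under an
  environment of reducible values. Each evaluation position is handled by
  \<open>terminates_fill\<close>.\<close>

lemma typing_terminates:
  assumes "typing S \<Gamma> M \<sigma>"
    and "\<And>i. i < length \<Gamma> \<Longrightarrow> red S (\<Gamma> ! i) (\<theta> i)" and "\<And>i. closed_trm (\<theta> i)"
  shows "terminates S (red S \<sigma>) (psubst M \<theta> 0)"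
  using assms
proof (induction arbitrary: \<theta> rule: typing.induct)
  case (Var i \<Gamma>)
  then show ?case by (auto intro!: terminates_value)
next
  case (Const \<Gamma> c)
  then show ?case using terminates_value[of S "Base (const_ty S c)" "Const c"] by simp
next
  case (Fn \<Gamma> Ms f)
  have "list_all2 (\<lambda>M b. terminates S (red S (Base b)) M)
      (map (\<lambda>M. psubst M \<theta> 0) Ms) (arg_tys S f)"
    using Fn by (auto simp: list_all2_conv_all_nth)
  then show ?case using terminates_Fn[of _ _ "[]" f] by simp
next
  case (Cond \<Gamma> L M \<sigma> N)
  have "terminates S (red S \<sigma>) (fill (CondC1 Hole (psubst M \<theta> 0) (psubst N \<theta> 0)) (psubst L \<theta> 0))"
  proof (rule terminates_fill[OF Cond.IH(1)])
    show "eval_ctx (CondC1 Hole (psubst M \<theta> 0) (psubst N \<theta> 0))" by (intro eval_ctx.intros)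
    fix V assume "red S (Base (bool_ty S)) V"
    then show "terminates S (red S \<sigma>) (fill (CondC1 Hole (psubst M \<theta> 0) (psubst N \<theta> 0)) V)"
      using bool_const Cond terminates_redex redex.intros(2,3)
      by (metis fill.simps(1,3) red.simps(1))
  qed (use Cond in auto)
  then show ?case by simp
next
  case (Or \<Gamma> M \<sigma> N)
  then show ?case using terminates_Or[OF eval_ctx.intros(1)] by fastforce
next
  case (PChoice p \<Gamma> M \<sigma> N)
  then show ?case using terminates_PChoice[OF eval_ctx.intros(1)] by fastforce
next
  case (Rwd \<Gamma> N M \<sigma>)
  have "terminates S (red S \<sigma>) (fill (RwdC1 Hole (psubst M \<theta> 0)) (psubst N \<theta> 0))"
  proof (rule terminates_fill[OF Rwd.IH(1)])
    show "eval_ctx (RwdC1 Hole (psubst M \<theta> 0))" by (intro eval_ctx.intros)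
    fix V assume "red S (Base (rew_ty S)) V"
    then show "terminates S (red S \<sigma>) (fill (RwdC1 Hole (psubst M \<theta> 0)) V)"
      using Rwd terminates_Rwd[OF eval_ctx.intros(1)] by fastforce
  qed (use Rwd in auto)
  then show ?case by simp
next
  case (Star \<Gamma>)
  then show ?case using terminates_value[of S UnitT Star] by simp
next
  case (MkPair \<Gamma> M \<sigma> N \<tau>)
  have "terminates S (red S (ProdT \<sigma> \<tau>)) (fill (PairC1 Hole (psubst N \<theta> 0)) (psubst M \<theta> 0))"
  proof (rule terminates_fill[OF MkPair.IH(1)])
    show "eval_ctx (PairC1 Hole (psubst N \<theta> 0))" by (intro eval_ctx.intros)
    fix V assume V: "red S \<sigma> V"
    \<comment> \<open>The right component is evaluated only once the left one is a value, so the
      second use of \<open>terminates_fill\<close> is nested in the first.\<close>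
    have "terminates S (red S (ProdT \<sigma> \<tau>)) (fill (PairC2 V Hole) (psubst N \<theta> 0))"
    proof (rule terminates_fill[OF MkPair.IH(2)])
      show "eval_ctx (PairC2 V Hole)"
        using red_closed_value[OF V] by (intro eval_ctx.intros) auto
      fix W assume "red S \<tau> W"
      then show "terminates S (red S (ProdT \<sigma> \<tau>)) (fill (PairC2 V Hole) W)"
        using terminates_value[of S "ProdT \<sigma> \<tau>" "MkPair V W"] V by simp
    qed (use MkPair in auto)
    then show "terminates S (red S (ProdT \<sigma> \<tau>)) (fill (PairC1 Hole (psubst N \<theta> 0)) V)" by simp
  qed (use MkPair in auto)
  then show ?case by simp
next
  case (Fst \<Gamma> M \<sigma> \<tau>)
  have "terminates S (red S \<sigma>) (fill (FstC Hole) (psubst M \<theta> 0))"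
  proof (rule terminates_fill[OF Fst.IH])
    show "eval_ctx (FstC Hole)" by (intro eval_ctx.intros)
    fix V assume "red S (ProdT \<sigma> \<tau>) V"
    then show "terminates S (red S \<sigma>) (fill (FstC Hole) V)"
      using terminates_redex[OF redex.intros(4)] terminates_value red_closed_value by fastforce
  qed (use Fst in auto)
  then show ?case by simp
next
  case (Snd \<Gamma> M \<sigma> \<tau>)
  have "terminates S (red S \<tau>) (fill (SndC Hole) (psubst M \<theta> 0))"
  proof (rule terminates_fill[OF Snd.IH])
    show "eval_ctx (SndC Hole)" by (intro eval_ctx.intros)
    fix V assume "red S (ProdT \<sigma> \<tau>) V"
    then show "terminates S (red S \<tau>) (fill (SndC Hole) V)"
      using terminates_redex[OF redex.intros(5)] terminates_value red_closed_value by fastforce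
  qed (use Snd in auto)
  then show ?case by simp
next
  case (Lam \<sigma> \<Gamma> M \<tau>)
  have "terminates S (red S \<tau>) (subst (psubst M \<theta> (Suc 0)) W 0)" if W: "red S \<sigma> W" for W
  proof -
    have cl: "closed_trm W" using red_closed_value[OF W] by simp
    have "terminates S (red S \<tau>) (psubst M (case_nat W \<theta>) 0)"
      using Lam W cl by (intro Lam.IH) (auto simp: less_Suc_eq_0_disj split: nat.split)
    then show ?thesis using subst_psubst[OF Lam.prems(2) cl] by simp
  qed
  then have "red S (FunT \<sigma> \<tau>) (psubst (Lam \<sigma> M) \<theta> 0)"
    using closed_psubst[OF Lam.prems(2), where M = "Lam \<sigma> M"] by simp
  then show ?case by (rule terminates_value)
next
  case (App \<Gamma> M \<sigma> \<tau> N)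
  have "terminates S (red S \<tau>) (fill (AppC1 Hole (psubst N \<theta> 0)) (psubst M \<theta> 0))"
  proof (rule terminates_fill[OF App.IH(1)])
    show "eval_ctx (AppC1 Hole (psubst N \<theta> 0))" by (intro eval_ctx.intros)
    fix V assume "red S (FunT \<sigma> \<tau>) V"
    then obtain P where P: "V = Lam \<sigma> P"
      "\<And>W. red S \<sigma> W \<Longrightarrow> terminates S (red S \<tau>) (subst P W 0)" by auto
    have "terminates S (red S \<tau>) (fill (AppC2 (Lam \<sigma> P) Hole) (psubst N \<theta> 0))"
    proof (rule terminates_fill[OF App.IH(2)])
      show "eval_ctx (AppC2 (Lam \<sigma> P) Hole)" by (intro eval_ctx.intros)
      fix W assume W: "red S \<sigma> W"
      then show "terminates S (red S \<tau>) (fill (AppC2 (Lam \<sigma> P) Hole) W)"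
        using P terminates_redex[OF redex.intros(6)] red_closed_value by fastforce
    qed (use App in auto)
    then show "terminates S (red S \<tau>) (fill (AppC1 Hole (psubst N \<theta> 0)) V)" using P by simp
  qed (use App in auto)
  then show ?case by simp
qed

lemma program_evaluates:
  assumes "program S M \<sigma>"
  obtains E where "evaluates S M E" and "eff_ok (\<lambda>c. const_ty S c = rew_ty S) (red S \<sigma>) E"
proof -
  \<comment> \<open>Any closed environment would do: a program is unchanged by
    \<open>psubst\<close>.\<close>
  have "terminates S (red S \<sigma>) (psubst M (\<lambda>_. Star) 0)"
    using assms unfolding program_def
    by (intro typing_terminates) (auto simp: closed_trm_def)
  then show ?thesis
    using that psubst_typed assms unfolding program_def terminates_def by fastforce
qed

end

section \<open>Optimal strategies\<close>

inductive_simps strat_less_simps [simp]: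
  "strat_less StratVal t" "strat_less (StratL s) t" "strat_less (StratR s) t" "strat_less (StratPair s s') t"

lemma strat_less_irrefl: "\<not> strat_less s s"
  by (induction s) auto

lemma strat_less_asym: "strat_less s t \<Longrightarrow> \<not> strat_less t s"
  by (induction rule: strat_less.induct) (auto simp: strat_less_irrefl)

lemma strat_less_trans: "strat_less s t \<Longrightarrow> strat_less t u \<Longrightarrow> strat_less s u"
  by (induction arbitrary: u rule: strat_less.induct) auto

lemma strat_less_total:
  "s \<in> Str E \<Longrightarrow> t \<in> Str E \<Longrightarrow> s = t \<or> strat_less s t \<or> strat_less t s"
  by (induction E arbitrary: s t) (auto, blast+)

lemma finite_Str: "finite (Str E)"
proof (induction E)
  case (EPChoice p E1 E2)
  have "Str (EPChoice p E1 E2) = (\<lambda>(s, t). StratPair s t) ` (Str E1 \<times> Str E2)" by auto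
  then show ?case using EPChoice by simp
qed auto

lemma Str_nonempty: "Str E \<noteq> {}"
  by (induction E) auto

text \<open>Totality of \<open>strat_less\<close> is available only within one \<open>Str E\<close>,
  hence the bound on \<open>A\<close>.\<close>

lemma least_strat_exists:
  assumes "finite A" and "A \<noteq> {}" and "A \<subseteq> Str E"
  shows "\<exists>s\<in>A. \<forall>t\<in>A. s = t \<or> strat_less s t"
  using assms
proof (induction rule: finite_ne_induct)
  case (insert x A)
  then obtain s where s: "s \<in> A" "\<forall>t\<in>A. s = t \<or> strat_less s t" by auto
  then have "s = x \<or> strat_less s x \<or> strat_less x s"
    using insert strat_less_total[of s E x] by auto
  then show ?case using s strat_less_trans by (metis insert_iff)
qed auto

lemma s_opt_eqI:
  assumes "maximizing I E s" and "\<And>t. maximizing I E t \<Longrightarrow> s = t \<or> strat_less s t"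
  shows "s_opt I E = s"
  unfolding s_opt_def using assms strat_less_asym by (intro the_equality) blast+

text \<open>There are finitely many strategies and at least one, so the maximal reward is attained
  and its maximizers have a least element; this justifies the definite description.\<close>

lemma s_opt_least:
  shows "maximizing I E (s_opt I E)"
    and "maximizing I E t \<Longrightarrow> s_opt I E = t \<or> strat_less (s_opt I E) t"
proof -
  let ?A = "{s. maximizing I E s}"
  have "Max (Rew I E ` Str E) \<in> Rew I E ` Str E"
    by (intro Max_in) (simp_all add: finite_Str Str_nonempty)
  then obtain s where "s \<in> Str E" "Rew I E s = Max (Rew I E ` Str E)" by (metis imageE)
  then have "maximizing I E s" by (simp add: maximizing_def finite_Str)
  then have "?A \<noteq> {}" by auto
  moreover have "?A \<subseteq> Str E" by (auto simp: maximizing_def)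
  ultimately obtain s where s: "maximizing I E s" "\<And>t. maximizing I E t \<Longrightarrow> s = t \<or> strat_less s t"
    using least_strat_exists[of ?A E] finite_subset[OF _ finite_Str] by blast
  then have "s_opt I E = s" by (rule s_opt_eqI)
  with s show "maximizing I E (s_opt I E)"
    and "maximizing I E t \<Longrightarrow> s_opt I E = t \<or> strat_less (s_opt I E) t" by auto
qed

lemma expected_reward_return: "expected_reward b (return_pmf (r, x)) = r"
proof -
  define rxs where "rxs = (SOME rxs. distinct rxs \<and> set rxs = {(r, x)})"
  \<comment> \<open>On a singleton support the chosen enumeration is forced.\<close>
  have "distinct rxs \<and> set rxs = {(r, x)}"
    unfolding rxs_def by (rule someI[of _ "[(r, x)]"]) auto
  then have "rxs = [(r, x)]"
    by (metis distinct_card card_1_singleton_iff length_0_conv length_Suc_conv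
      One_nat_def list.set_intros(1) singletonD)
  then show ?thesis by (simp add: expected_reward_def rxs_def[symmetric])
qed

section \<open>Optimal strategies of a binary choice\<close>

lemma Rew_EOr [simp]:
  "Rew I (EOr E1 E2) (StratL s) = Rew I E1 s"
  "Rew I (EOr E1 E2) (StratR s) = Rew I E2 s"
  by (simp_all add: Rew_def)

lemma maximizing_EOr:
  "maximizing I (EOr E1 E2) (StratL s) \<longleftrightarrow>
    maximizing I E1 s \<and> (\<forall>t\<in>Str E2. Rew I E2 t \<le> Rew I E1 s)"
  "maximizing I (EOr E1 E2) (StratR s) \<longleftrightarrow>
    maximizing I E2 s \<and> (\<forall>t\<in>Str E1. Rew I E1 t \<le> Rew I E2 s)"
  by (auto simp: maximizing_def ball_Un)

lemma maximizing_EOr_cases: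
  assumes "maximizing I (EOr E1 E2) t"
  obtains s where "t = StratL s" | s where "t = StratR s"
  using assms by (auto simp: maximizing_def)

lemma maximizing_Rew_eq:
  assumes "maximizing I E s" and "maximizing I E t"
  shows "Rew I E s = Rew I E t"
  using assms by (simp add: maximizing_def order.antisym)

lemma s_opt_maximal:
  "s_opt I E \<in> Str E" "t \<in> Str E \<Longrightarrow> Rew I E t \<le> Rew I E (s_opt I E)"
  using s_opt_least(1)[of I E] by (auto simp: maximizing_def)

text \<open>Ties go to the left because all left strategies precede the right ones.\<close>

lemma s_opt_EOr_left:
  assumes "Rew I E2 (s_opt I E2) \<le> Rew I E1 (s_opt I E1)"
  shows "s_opt I (EOr E1 E2) = StratL (s_opt I E1)"
proof (rule s_opt_eqI)
  show "maximizing I (EOr E1 E2) (StratL (s_opt I E1))"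
    using order.trans[OF s_opt_maximal(2) assms] by (auto simp: maximizing_EOr s_opt_least(1))
  fix t assume t: "maximizing I (EOr E1 E2) t"
  then show "StratL (s_opt I E1) = t \<or> strat_less (StratL (s_opt I E1)) t"
    by (cases rule: maximizing_EOr_cases)
      (use t s_opt_least(2)[of I E1] in \<open>auto simp: maximizing_EOr\<close>)
qed

lemma s_opt_EOr_right:
  assumes "Rew I E1 (s_opt I E1) < Rew I E2 (s_opt I E2)"
  shows "s_opt I (EOr E1 E2) = StratR (s_opt I E2)"
proof (rule s_opt_eqI)
  show "maximizing I (EOr E1 E2) (StratR (s_opt I E2))"
    using order.trans[OF s_opt_maximal(2) less_imp_le[OF assms]]
    by (auto simp: maximizing_EOr s_opt_least(1))
  fix t assume t: "maximizing I (EOr E1 E2) t"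
  then show "StratR (s_opt I E2) = t \<or> strat_less (StratR (s_opt I E2)) t"
  proof (cases rule: maximizing_EOr_cases)
    case (1 s)
    \<comment> \<open>A left maximizer has the optimal reward of \<open>E1\<close> and would
      dominate every strategy of \<open>E2\<close>, against the strict inequality.\<close>
    then have "Rew I E2 (s_opt I E2) \<le> Rew I E1 (s_opt I E1)"
      using t s_opt_maximal(1)[of I E2] maximizing_Rew_eq[OF _ s_opt_least(1), of I E1 s]
      by (simp add: maximizing_EOr)
    then show ?thesis using assms by simp
  qed (use t s_opt_least(2)[of I E2] in \<open>auto simp: maximizing_EOr\<close>)
qed

section \<open>Denotability of expected rewards\<close>

lemma finite_set_Out: "s \<in> Str E \<Longrightarrow> finite (set_pmf (Out I E s))"
  by (induction E arbitrary: s) (auto simp: act_def mix_def)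

context interpreted_language
begin

definition denotable :: "'r \<Rightarrow> bool" where
  "denotable r \<longleftrightarrow> (\<exists>c. const_ty S c = rew_ty S \<and> const_den I c = RewD r)"

lemma denotable_zero: "denotable 0"
  using zero_ty const_den_zero by (auto simp: denotable_def)

lemma denotable_add:
  assumes "denotable r" and "denotable s"
  shows "denotable (r + s)"
proof -
  obtain c d where "const_ty S c = rew_ty S" "const_den I c = RewD r"
    "const_ty S d = rew_ty S" "const_den I d = RewD s"
    using assms by (auto simp: denotable_def)
  then show ?thesis
    using fn_den_val[of "[c, d]" "plus_sym S"] fn_val_ty[of "[c, d]" "plus_sym S"] plus_ty
      fn_den_plus by (auto simp: denotable_def)
qed

lemma denotable_bary:
  assumes "denotable r" and "denotable s" and "p \<in> {0..1}"
  shows "denotable (bary I p r s)"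
proof -
  obtain c d where "const_ty S c = rew_ty S" "const_den I c = RewD r"
    "const_ty S d = rew_ty S" "const_den I d = RewD s"
    using assms by (auto simp: denotable_def)
  then show ?thesis
    using fn_den_val[of "[c, d]" "oplus_sym S p"] fn_val_ty[of "[c, d]" "oplus_sym S p"]
      oplus_ty[OF assms(3)] fn_den_oplus[OF assms(3)] by (auto simp: denotable_def)
qed

lemma denotable_convex_comb:
  assumes "ws \<noteq> []" and "\<And>q x. (q, x) \<in> set ws \<Longrightarrow> 0 \<le> q \<and> denotable x"
    and "sum_list (map fst ws) \<le> 1"
  shows "denotable (convex_comb (bary I) ws)"
  using assms
proof (induction "bary I" ws rule: convex_comb.induct)
  case (3 p x w ws)
  let ?ws = "map (\<lambda>(q, y). (q / (1 - p), y)) (w # ws)"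
  have pts: "0 \<le> fst y \<and> denotable (snd y)" if "y \<in> set ((p, x) # w # ws)" for y
    using 3(3) that by (metis prod.collapse)
  have "0 \<le> sum_list (map fst (w # ws))"
    using pts by (intro sum_list_nonneg) (metis imageE list.set_map list.set_intros(2))
  then have p: "0 \<le> p" "p \<le> 1" using 3(3)[of p x] 3(4) by auto
  have "sum_list (map fst ?ws) = sum_list (map fst (w # ws)) / (1 - p)"
    by (simp add: case_prod_beta comp_def divide_inverse sum_list_mult_const distrib_right)
  also have "\<dots> \<le> 1" using 3(4) p by (cases "p = 1") (auto simp: divide_simps)
  finally have sum_le: "sum_list (map fst ?ws) \<le> 1" .
  have "denotable (convex_comb (bary I) ?ws)"
  proof (rule 3(1)[OF _ _ sum_le])
    fix q y assume "(q, y) \<in> set ?ws"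
    then obtain q' where "(q', y) \<in> set (w # ws)" "q = q' / (1 - p)"
      by (cases w) auto
    then show "0 \<le> q \<and> denotable y" using 3(3)[of q' y] p by simp
  qed simp
  then show ?case using 3(3)[of p x] p by (auto intro: denotable_bary)
qed auto

text \<open>The argument works for every enumeration of the support, hence for the chosen one;
  finiteness ensures that there is one to choose.\<close>

lemma denotable_expected_reward:
  assumes fin: "finite (set_pmf \<mu>)" and den: "\<And>r x. (r, x) \<in> set_pmf \<mu> \<Longrightarrow> denotable r"
  shows "denotable (expected_reward (bary I) \<mu>)"
proof -
  define rxs where "rxs = (SOME rxs. distinct rxs \<and> set rxs = set_pmf \<mu>)"
  have "\<exists>rxs. distinct rxs \<and> set rxs = set_pmf \<mu>"
    using finite_distinct_list[OF fin] by blast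
  from someI_ex[OF this] have rxs: "distinct rxs" "set rxs = set_pmf \<mu>"
    unfolding rxs_def by simp_all
  have "sum_list (map (pmf \<mu>) rxs) = 1"
    using rxs fin by (simp add: sum_list_distinct_conv_sum_set sum_pmf_eq_1)
  moreover have "rxs \<noteq> []" using rxs set_pmf_not_empty[of \<mu>] by auto
  ultimately have "denotable (convex_comb (bary I) (map (\<lambda>rx. (pmf \<mu> rx, fst rx)) rxs))"
    using den rxs by (intro denotable_convex_comb) (auto simp: comp_def)
  then show ?thesis by (simp add: expected_reward_def rxs_def)
qed

text \<open>An outcome reward is zero plus the denotations of the reward constants met on the way to
  a leaf.\<close>

lemma denotable_Out:
  assumes "s \<in> Str E" and "eff_ok (\<lambda>c. const_ty S c = rew_ty S) P E"
    and "(r, x) \<in> set_pmf (Out I E s)"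
  shows "denotable r"
  using assms
proof (induction E arbitrary: s r x)
  case (ERwd c E)
  \<comment> \<open>Ensures that \<open>rew_of\<close> is applied to a reward and not to another
    constructor, where it is unspecified.\<close>
  obtain r' where "const_den I c = RewD r'"
    using ERwd.prems(2) const_den_in[of c] base_den_rew by auto
  then have "denotable (rew_of (const_den I c))"
    using ERwd.prems(2) by (auto simp: denotable_def)
  then show ?case
    using ERwd by (auto simp: act_def intro: denotable_add)
next
  case (EPChoice p E1 E2)
  then show ?case by (auto simp: mix_def split: if_splits)
qed (auto simp: denotable_zero)

section \<open>The distinguishing context\<close>

lemma reward_distinguishable:
  assumes P: "program S P (Base (bool_ty S))" and Q: "program S Q (Base (bool_ty S))"
    and eq: "Ob_VDis S I P = Ob_VDis S I Q"
    and less: "expected_reward (bary I) (Op_s S I P) < expected_reward (bary I) (Op_s S I Q)"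
  obtains L where "program S L (Base (bool_ty S))"
    and "Ob_VDis S I (Or L P) \<noteq> Ob_VDis S I (Or L Q)"
proof -
  obtain E where E: "evaluates S P E" "eff_ok (\<lambda>c. const_ty S c = rew_ty S) (red S (Base (bool_ty S))) E"
    using program_evaluates[OF P] .
  obtain F where F: "evaluates S Q F"
    using program_evaluates[OF Q] .
  have "denotable (Rew I E (s_opt I E))"
    unfolding Rew_def
    using finite_set_Out[OF s_opt_maximal(1)] denotable_Out[OF s_opt_maximal(1) E(2)]
    by (rule denotable_expected_reward)
  then obtain c where c: "const_ty S c = rew_ty S" "const_den I c = RewD (Rew I E (s_opt I E))"
    by (auto simp: denotable_def)
  \<comment> \<open>Two different point distributions cannot both be the value distribution of
    \<open>Q\<close>, so some truth constant \<open>d\<close> qualifies.\<close>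
  have "return_pmf (Const (tt_const S)) \<noteq> (return_pmf (Const (ff_const S)) :: ('b, 'c, 'f) trm pmf)"
    using tt_neq_ff by simp
  then obtain d where d: "const_ty S d = bool_ty S" "return_pmf (Const d) \<noteq> Ob_VDis S I Q"
    using tt_ty ff_ty by metis
  let ?L = "Rwd (Const c) (Const d) :: ('b, 'c, 'f) trm"
    and ?E = "ERwd c (EVal (Const d)) :: ('b, 'c, 'f) effval"
  have "evaluates S ?L ?E"
    using evaluates.intros(5)[OF eval_ctx.intros(1), of S "Const d" "EVal (Const d)" c]
      evaluates.intros(1)[of "Const d" S] by simp
  then have Op_Or: "Op S (Or ?L R) = EOr ?E G" if "evaluates S R G" for R G
    using evaluates.intros(3)[OF eval_ctx.intros(1), of S ?L ?E R G] that
    by (intro Op_eq) simp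
  \<comment> \<open>\<open>?E\<close> offers no choice, so \<open>Out\<close> ignores the strategy
    here.\<close>
  have Out_L: "Out I ?E s = return_pmf (Rew I E (s_opt I E), Const d)" for s
    using c by (simp add: act_def)
  then have Rew_L: "Rew I ?E s = Rew I E (s_opt I E)" for s
    by (simp add: Rew_def expected_reward_return)
  \<comment> \<open>Equal optimal rewards: the left branch is selected.\<close>
  have "Ob_VDis S I (Or ?L P) = return_pmf (Const d)"
    using Op_Or[OF E(1)] s_opt_EOr_left[of I E ?E] Rew_L Out_L
    by (simp add: Ob_VDis_def Op_s_def VDis_def)
  \<comment> \<open>The reward of \<open>?L\<close> is strictly below the optimum of
    \<open>Q\<close>: the right branch is selected.\<close>
  moreover have "Ob_VDis S I (Or ?L Q) = Ob_VDis S I Q"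
    using Op_Or[OF F] s_opt_EOr_right[of I ?E F] Rew_L less Op_eq[OF E(1)] Op_eq[OF F]
    by (simp add: Ob_VDis_def Op_s_def VDis_def Rew_def)
  ultimately have "Ob_VDis S I (Or ?L P) \<noteq> Ob_VDis S I (Or ?L Q)"
    using d by simp
  moreover have "program S ?L (Base (bool_ty S))"
    using c(1) d(1) unfolding program_def by (metis typing.Rwd typing.Const)
  ultimately show ?thesis using that by blast
qed

text \<open>A strictly larger reward on the side of \<open>N\<close> would yield a separating
  \<open>L\<close>, and \<open>OrC2 L C\<close> would then distinguish \<open>M\<close> from
  \<open>N\<close>.\<close>

lemma obs_equiv_VDis_expected_reward_le:
  assumes "program S M \<sigma>" and "program S N \<sigma>"
    and equiv: "obs_equiv S (Ob_VDis S I) \<sigma> M N"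
    and C: "\<forall>L. program S L \<sigma> \<longrightarrow> program S (fill C L) (Base (bool_ty S))"
  shows "expected_reward (bary I) (Op_s S I (fill C N)) \<le> expected_reward (bary I) (Op_s S I (fill C M))"
proof (rule ccontr)
  assume "\<not> ?thesis"
  moreover have "Ob_VDis S I (fill C M) = Ob_VDis S I (fill C N)"
    using equiv C by (auto simp: obs_equiv_def)
  ultimately obtain L where L: "program S L (Base (bool_ty S))"
    "Ob_VDis S I (Or L (fill C M)) \<noteq> Ob_VDis S I (Or L (fill C N))"
    using reward_distinguishable[of "fill C M" "fill C N"] assms(1,2) C by (metis not_le)
  have "\<forall>K. program S K \<sigma> \<longrightarrow> program S (fill (OrC2 L C) K) (Base (bool_ty S))"
    using C L(1) by (auto simp: program_def intro: typing.Or)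
  then have "Ob_VDis S I (fill (OrC2 L C) M) = Ob_VDis S I (fill (OrC2 L C) N)"
    using equiv unfolding obs_equiv_def by blast
  then show False using L(2) by simp
qed

end

theorem theorem5p17:
  fixes S :: "('b, 'c, 'f) lang_sig"
    and I :: "('b, 'c, 'f, 'r::{comm_monoid_add, linorder}, 'd) interp"
    and \<sigma> :: "'b ty"
    and M N :: "('b, 'c, 'f) trm"
  assumes "interpreted_language S I"
    and "program S M \<sigma>" and "program S N \<sigma>"
  shows "obs_equiv S (Ob_T3 S I) \<sigma> M N \<longleftrightarrow> obs_equiv S (Ob_VDis S I) \<sigma> M N"
proof
  assume "obs_equiv S (Ob_T3 S I) \<sigma> M N"
  then show "obs_equiv S (Ob_VDis S I) \<sigma> M N"
    by (auto simp: obs_equiv_def Ob_T3_def Ob_VDis_def)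
next
  interpret interpreted_language S I by fact
  assume MN: "obs_equiv S (Ob_VDis S I) \<sigma> M N"
  then have NM: "obs_equiv S (Ob_VDis S I) \<sigma> N M"
    by (simp add: obs_equiv_def)
  show "obs_equiv S (Ob_T3 S I) \<sigma> M N"
    unfolding obs_equiv_def
  proof (intro allI impI)
    fix C assume C: "\<forall>L. program S L \<sigma> \<longrightarrow> program S (fill C L) (Base (bool_ty S))"
    have "Ob_VDis S I (fill C M) = Ob_VDis S I (fill C N)"
      using MN C by (auto simp: obs_equiv_def)
    then show "Ob_T3 S I (fill C M) = Ob_T3 S I (fill C N)"
      \<comment> \<open>The inequality in both directions makes the expected rewards equal.\<close>
      using obs_equiv_VDis_expected_reward_le[OF assms(2,3) MN C]
        obs_equiv_VDis_expected_reward_le[OF assms(3,2) NM C]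
      by (simp add: Ob_T3_def Ob_VDis_def)
  qed
qed

end
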